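(* Let $C(n)$ denote the maximum number of touching pairs among all packings of $n$ congruent spheres in $\mathbb{R}^3$. Then $$C(6)=12.$$
   Context: A packing of $n$ congruent spheres in $\mathbb{R}^3$ is a family of $n$ spheres $x_i+\mathbb{S}^2$ ($1\le i\le n$, $x_i\in\mathbb{R}^3$, where $\mathbb{S}^2$ is the unit sphere centered at the origin) bounding closed unit balls with pairwise disjoint interiors; equivalently, $\|x_i-x_j\|\ge 2$ for all $i\ne j$. A touching pair is an unordered pair $\{i,j\}$ with $i\neq j$ such that the two spheres are tangent, i.e. $\|x_i-x_j\|=2$. The contact number $C(n)$ is the maximum, over all such packings of $n$ spheres, of the number of touching pairs. *)

theory Defs
  imports "HOL-Analysis.Analysis"
begin

text \<open>
  A family of \<open>n\<close> unit spheres is given by its centers \<open>x 1, \<dots>, x n\<close>; the values of \<open>x\<close> at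
  other indices are irrelevant.
\<close>

definition sphere_packing :: "nat \<Rightarrow> (nat \<Rightarrow> real^3) \<Rightarrow> bool" where
  "sphere_packing n x \<longleftrightarrow>
     (\<forall>i\<in>{1..n}. \<forall>j\<in>{1..n}. i \<noteq> j \<longrightarrow>
        interior (cball (x i) 1) \<inter> interior (cball (x j) 1) = {})"

definition touching_pairs :: "nat \<Rightarrow> (nat \<Rightarrow> real^3) \<Rightarrow> nat set set" where
  "touching_pairs n x =
     {{i, j} | i j. i \<in> {1..n} \<and> j \<in> {1..n} \<and> i \<noteq> j \<and> norm (x i - x j) = 2}"

definition contact_number :: "nat \<Rightarrow> nat" where
  "contact_number n = Max {card (touching_pairs n x) | x. sphere_packing n x}"

lemma sphere_packing_iff:
  "sphere_packing n x \<longleftrightarrow>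
     (\<forall>i\<in>{1..n}. \<forall>j\<in>{1..n}. i \<noteq> j \<longrightarrow> norm (x i - x j) \<ge> 2)"
proof -
  have "ball a 1 \<inter> ball b 1 = {} \<longleftrightarrow> norm (a - b) \<ge> 2" for a b :: "real^3"
  proof
    assume disj: "ball a 1 \<inter> ball b 1 = {}"
    show "norm (a - b) \<ge> 2"
    proof (rule ccontr)
      assume "\<not> norm (a - b) \<ge> 2"
      then have "dist a b < 2"
        by (simp add: dist_norm)
      then have "midpoint a b \<in> ball a 1 \<inter> ball b 1"
        by (simp add: dist_midpoint)
      with disj show False by blast
    qed
  next
    assume "norm (a - b) \<ge> 2"
    then show "ball a 1 \<inter> ball b 1 = {}"
      by (intro disjoint_ballI) (simp add: dist_norm)
  qed
  then show ?thesis
    unfolding sphere_packing_def by simp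
qed

text \<open>The maximum defining \<^const>\<open>contact_number\<close> is over a finite nonempty set.\<close>

lemma finite_contact_values:
  "finite {card (touching_pairs n x) | x. sphere_packing n x}"
proof (rule finite_subset)
  show "{card (touching_pairs n x) | x. sphere_packing n x} \<subseteq> card ` Pow (Pow {1..n})"
    by (auto simp: touching_pairs_def intro!: imageI)
qed simp

lemma contact_values_nonempty:
  "{card (touching_pairs n x) | x. sphere_packing n x} \<noteq> {}"
proof -
  define x :: "nat \<Rightarrow> real^3" where "x i = (2 * real i) *\<^sub>R axis 1 1" for i
  have "sphere_packing n x"
    unfolding sphere_packing_iff
  proof (intro ballI impI)
    fix i j :: nat
    assume "i \<noteq> j"
    then have "\<bar>real i - real j\<bar> \<ge> 1" by linarith
    moreover have "norm (x i - x j) = \<bar>2 * real i - 2 * real j\<bar>"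
      by (simp add: x_def norm_axis_1 flip: scaleR_diff_left)
    ultimately show "norm (x i - x j) \<ge> 2" by linarith
  qed
  then show ?thesis by blast
qed

end

theory Submission
  imports Defs
begin

text \<open>
  The regular octahedron of edge \<open>2\<close> gives \<open>12\<close> touching pairs: the \<open>15\<close> pairs of vertices
  without the three pairs of antipodes.

  Conversely, suppose that at least \<open>13\<close> pairs touch, so that at most two of the \<open>15\<close> pairs do not.
  The whole geometric content of the upper bound is \<open>apexes_of_triangle\<close>: over a triangle of
  mutually touching spheres in three-space, a sphere touching all three has only two possible
  positions, exchanged by the reflection in the plane of the triangle, so the two positions
  have the centroid of the triangle as their midpoint.
  If the two missing pairs share a vertex, deleting it leaves five mutually touching spheres.
  If they are disjoint, say \<open>{a, b}\<close> and \<open>{c, d}\<close> with \<open>e, f\<close> the remaining indices, then \<open>a\<close> and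
  \<open>b\<close> are the two positions over the triangle \<open>c e f\<close> and also over the triangle \<open>d e f\<close>.
  Equating the two midpoints gives \<open>c = d\<close>, a contradiction.  Among five mutually touching
  spheres, fix one of them, \<open>u\<close>: two further ones, \<open>p\<close> and \<open>v\<close>, are each the position opposite
  to \<open>u\<close> over the triangle of the other three, and the same comparison gives \<open>p = v\<close>.
\<close>

section \<open>Spheres touching three mutually touching spheres\<close>

abbreviation touch :: "real^3 \<Rightarrow> real^3 \<Rightarrow> bool" where
  "touch p q \<equiv> norm (p - q) = 2"

lemma touch_commute: "touch p q \<longleftrightarrow> touch q p"
  by (simp add: norm_minus_commute)

lemma orthogonal_to_three_imp_zero:
  fixes a b c z :: "real^3"
  assumes nz: "a \<noteq> 0" "b \<noteq> 0" "c \<noteq> 0"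
    and orth: "a \<bullet> b = 0" "a \<bullet> c = 0" "b \<bullet> c = 0" "z \<bullet> a = 0" "z \<bullet> b = 0" "z \<bullet> c = 0"
  shows "z = 0"
proof (rule ccontr)
  assume z: "z \<noteq> 0"
  have "pairwise orthogonal {a, b, c, z}"
    using orth by (auto simp: pairwise_def orthogonal_def inner_commute)
  moreover have "0 \<notin> {a, b, c, z}"
    using nz z by auto
  ultimately have "independent {a, b, c, z}"
    by (rule pairwise_orthogonal_independent)
  then have "card {a, b, c, z} \<le> 3"
    using independent_bound[of "{a, b, c, z}"] by simp
  moreover have "a \<noteq> b" "a \<noteq> c" "b \<noteq> c" "z \<noteq> a" "z \<noteq> b" "z \<noteq> c"
    using nz orth by auto
  ultimately show False
    by auto
qed

text \<open>
  With \<open>p\<close> as origin, the difference between \<open>u + v\<close> and twice the centroid is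
  orthogonal to the plane of the triangle, because \<open>u\<close> and \<open>v\<close> project to the centroid, and to
  \<open>u - v\<close>, because \<open>u\<close> and \<open>v\<close> have the same length.  As \<open>u - v\<close> is itself
  normal to that plane, no direction is left for this difference.
\<close>

lemma apexes_of_triangle:
  assumes triangle: "touch p q" "touch p r" "touch q r"
    and u: "touch u p" "touch u q" "touch u r"
    and v: "touch v p" "touch v q" "touch v r"
    and "u \<noteq> v"
  shows "u + v = (2/3) *\<^sub>R (p + q + r)"
proof -
  define Q R U V where "Q = q - p" "R = r - p" "U = u - p" "V = v - p"
  have norms: "Q \<bullet> Q = 4" "R \<bullet> R = 4" "U \<bullet> U = 4" "V \<bullet> V = 4"
    using triangle u v unfolding Q_R_U_V_def dot_square_norm
    by (simp_all add: norm_minus_commute)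
  have two: "X \<bullet> Y = 2" if "X \<bullet> X = 4" "Y \<bullet> Y = 4" "norm (X - Y) = 2" for X Y :: "real^3"
  proof -
    have "(X - Y) \<bullet> (X - Y) = 4"
      using that(3) by (simp add: dot_square_norm)
    with that(1,2) show ?thesis
      by (simp add: inner_diff_left inner_diff_right inner_commute)
  qed
  have inners: "Q \<bullet> R = 2" "U \<bullet> Q = 2" "U \<bullet> R = 2" "V \<bullet> Q = 2" "V \<bullet> R = 2"
    by (rule two; use triangle u v norms in \<open>simp add: Q_R_U_V_def\<close>)+
  note products = norms inners inners[THEN trans[OF inner_commute]]
  have "U + V - (2/3) *\<^sub>R (Q + R) = 0"
  proof (rule orthogonal_to_three_imp_zero)
    \<comment> \<open>An orthogonal basis: the edge \<open>Q\<close>, the median of the triangle perpendicular to it,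
      and the normal direction \<open>U - V\<close>.\<close>
    show "Q \<noteq> 0"
      using norms by auto
    have "(2 *\<^sub>R R - Q) \<bullet> (2 *\<^sub>R R - Q) = 12"
      by (simp add: inner_simps products)
    then show "2 *\<^sub>R R - Q \<noteq> 0"
      by auto
    show "U - V \<noteq> 0"
      using \<open>u \<noteq> v\<close> by (simp add: Q_R_U_V_def)
  qed (simp_all add: inner_simps products inner_commute[of U V])
  moreover have "u + v - (2/3) *\<^sub>R (p + q + r) = U + V - (2/3) *\<^sub>R (Q + R)"
    by (simp add: Q_R_U_V_def vec_eq_iff field_simps)
  ultimately show ?thesis
    by simp
qed

lemma not_five_mutually_touching:
  assumes "touch p q" "touch p r" "touch p u" "touch p v" "touch q r" "touch q u" "touch q v"
    "touch r u" "touch r v" "touch u v"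
  shows False
proof -
  \<comment> \<open>Opposite to \<open>u\<close> lies \<open>v\<close> over the triangle \<open>p q r\<close> and \<open>p\<close> over the triangle \<open>v q r\<close>;
    subtracting the two equations leaves \<open>v - p = (2/3) (p - v)\<close>.\<close>
  have "u \<noteq> v" "u \<noteq> p" "p \<noteq> v"
    using assms by auto
  then have "u + v = (2/3) *\<^sub>R (p + q + r)" "u + p = (2/3) *\<^sub>R (v + q + r)"
    using assms by (auto intro!: apexes_of_triangle simp: touch_commute)
  then have "p = v"
    by (simp add: vec_eq_iff) (smt (verit))
  with \<open>p \<noteq> v\<close> show False by simp
qed

lemma not_all_but_two_disjoint_touching:
  assumes "touch e f"
    and "touch a c" "touch a d" "touch a e" "touch a f"
    and "touch b c" "touch b d" "touch b e" "touch b f"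
    and "touch c e" "touch c f" "touch d e" "touch d f"
    and "a \<noteq> b" "c \<noteq> d"
  shows False
proof -
  have "a + b = (2/3) *\<^sub>R (c + e + f)" "a + b = (2/3) *\<^sub>R (d + e + f)"
    using assms by (auto intro!: apexes_of_triangle)
  with \<open>c \<noteq> d\<close> show False by simp
qed

section \<open>At most twelve touching pairs\<close>

abbreviation index_pairs :: "nat set set" where
  "index_pairs \<equiv> {A. A \<subseteq> {1..6} \<and> card A = 2}"

lemma card_index_pairs: "card index_pairs = 15"
  by (simp add: n_subsets choose_two)

lemma touching_pairs_subset: "touching_pairs 6 x \<subseteq> index_pairs"
  by (auto simp: touching_pairs_def)

lemma touching_pairs_iff:
  assumes "i \<in> {1..n}" "j \<in> {1..n}" "i \<noteq> j"
  shows "{i, j} \<in> touching_pairs n x \<longleftrightarrow> touch (x i) (x j)"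
  using assms by (auto simp: touching_pairs_def doubleton_eq_iff norm_minus_commute)

text \<open>
  Padding a set of fewer than two missing pairs lets two cases cover everything: the two pairs
  \<open>A\<close> and \<open>B\<close>, possibly equal, intersect or are disjoint.
\<close>

lemma subset_pair_if_card_le_2:
  assumes "finite N" "card N \<le> 2" "N \<subseteq> S" "S \<noteq> {}"
  obtains A B where "A \<in> S" "B \<in> S" "N \<subseteq> {A, B}"
proof -
  consider "N = {}" | A where "N = {A}" | A B where "N = {A, B}"
    using assms(1,2) by (metis card_0_eq card_1_singletonE card_2_iff le_SucE le_zero_eq
        numeral_2_eq_2 One_nat_def)
  then show thesis
    using that assms(3,4) by cases blast+
qed

lemma card_touching_pairs_le_12:
  assumes packing: "sphere_packing 6 x"
  shows "card (touching_pairs 6 x) \<le> 12"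
proof (rule ccontr)
  let ?N = "index_pairs - touching_pairs 6 x"
  assume "\<not> card (touching_pairs 6 x) \<le> 12"
  moreover have fin: "finite index_pairs"
    by simp
  ultimately have "card ?N \<le> 2"
    using touching_pairs_subset card_index_pairs
    using finite_subset[OF touching_pairs_subset fin, of x]
    by (simp add: card_Diff_subset)
  moreover have "{1, 2} \<in> index_pairs"
    by simp
  ultimately obtain A B where AB: "A \<in> index_pairs" "B \<in> index_pairs" and N: "?N \<subseteq> {A, B}"
    using subset_pair_if_card_le_2[of ?N index_pairs] fin by blast
  have touch: "touch (x i) (x j)"
    if "i \<in> {1..6}" "j \<in> {1..6}" "i \<noteq> j" "{i, j} \<noteq> A" "{i, j} \<noteq> B" for i j
  proof -
    have "{i, j} \<in> index_pairs"
      using that by simp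
    with that N show ?thesis
      using touching_pairs_iff[of i 6 j x] by blast
  qed
  have distinct: "x i \<noteq> x j" if "i \<in> {1..6}" "j \<in> {1..6}" "i \<noteq> j" for i j
    using packing that unfolding sphere_packing_iff by fastforce
  show False
  proof (cases "A \<inter> B = {}")
    case False
    then obtain w where w: "w \<in> A" "w \<in> B"
      by blast
    then have "card ({1..6} - {w}) = 5"
      using AB by (subst card_Diff_singleton) auto
    moreover obtain js where js: "set js = {1..6} - {w}" "distinct js"
      using finite_distinct_list[of "{1..6} - {w}"] by auto
    ultimately have "length js = 5"
      by (metis distinct_card)
    then obtain p q r u v where "js = [p, q, r, u, v]"
      by (auto simp: numeral_eq_Suc length_Suc_conv)
    with js have five: "{1..6} - {w} = {p, q, r, u, v}" and "distinct [p, q, r, u, v]"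
      by auto
    \<comment> \<open>Both exceptional pairs contain \<open>w\<close>, so all pairs avoiding \<open>w\<close> touch.\<close>
    have "touch (x i) (x j)" if "i \<in> {1..6} - {w}" "j \<in> {1..6} - {w}" "i \<noteq> j" for i j
      using that w by (intro touch) auto
    then show False
      using \<open>distinct [p, q, r, u, v]\<close> unfolding five
      by (intro not_five_mutually_touching[of "x p" "x q" "x r" "x u" "x v"]) auto
  next
    case True
    obtain a b where A: "A = {a, b}" "a \<noteq> b"
      using AB(1) by (auto simp: card_2_iff)
    obtain c d where B: "B = {c, d}" "c \<noteq> d"
      using AB(2) by (auto simp: card_2_iff)
    have "card ({1..6} - {a, b, c, d}) = 2"
      using A B AB True by (subst card_Diff_subset) auto
    then obtain e f where ef: "{1..6} - {a, b, c, d} = {e, f}" "e \<noteq> f"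
      by (auto simp: card_2_iff)
    then have "e \<in> {1..6} - {a, b, c, d}" "f \<in> {1..6} - {a, b, c, d}"
      by blast+
    then show False
      using A B AB True \<open>e \<noteq> f\<close>
      by (intro not_all_but_two_disjoint_touching[of "x e" "x f" "x a" "x c" "x d" "x b"]
          touch distinct) (auto simp: doubleton_eq_iff)
  qed
qed

section \<open>The octahedron\<close>

text \<open>
  Vertices \<open>2 k - 1\<close> and \<open>2 k\<close> are the two antipodes on the \<open>k\<close>-th coordinate axis.
\<close>

definition octahedron_axis :: "nat \<Rightarrow> 3" where
  "octahedron_axis i = (if i \<le> 2 then 1 else if i \<le> 4 then 2 else 3)"

definition octahedron :: "nat \<Rightarrow> real^3" where
  "octahedron i = axis (octahedron_axis i) (if odd i then sqrt 2 else - sqrt 2)"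

lemma touch_octahedron:
  assumes "octahedron_axis i \<noteq> octahedron_axis j"
  shows "touch (octahedron i) (octahedron j)"
proof -
  have "(norm (octahedron i - octahedron j))\<^sup>2 = 2\<^sup>2"
    using assms unfolding power2_norm_eq_inner
    by (simp add: octahedron_def inner_simps inner_axis_axis)
  then show ?thesis
    by (rule power2_eq_imp_eq) simp_all
qed

lemma octahedron_axis_eq_cases:
  assumes "i \<in> {1..6}" "j \<in> {1..6}" "i \<noteq> j" "octahedron_axis i = octahedron_axis j"
  shows "odd i \<longleftrightarrow> even j" "{i, j} \<in> {{1, 2}, {3, 4}, {5, 6}}"
proof -
  have "i \<in> {1, 2, 3, 4, 5, 6}" "j \<in> {1, 2, 3, 4, 5, 6}"
    using assms by auto
  with assms show "odd i \<longleftrightarrow> even j" "{i, j} \<in> {{1, 2}, {3, 4}, {5, 6}}"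
    by (auto simp: octahedron_axis_def)
qed

lemma sphere_packing_octahedron: "sphere_packing 6 octahedron"
  unfolding sphere_packing_iff
proof (intro ballI impI)
  fix i j :: nat
  assume ij: "i \<in> {1..6}" "j \<in> {1..6}" "i \<noteq> j"
  show "norm (octahedron i - octahedron j) \<ge> 2"
  proof (cases "octahedron_axis i = octahedron_axis j")
    case True
    have "(norm (octahedron i - octahedron j))\<^sup>2 = 8"
      using True octahedron_axis_eq_cases(1)[OF ij True] unfolding power2_norm_eq_inner
      by (cases "odd i") (simp_all add: octahedron_def inner_simps inner_axis_axis)
    then have "2\<^sup>2 \<le> (norm (octahedron i - octahedron j))\<^sup>2"
      by simp
    then show ?thesis
      by (rule power2_le_imp_le) simp
  next
    case False
    then show ?thesis
      using touch_octahedron by simp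
  qed
qed

lemma card_touching_pairs_octahedron: "card (touching_pairs 6 octahedron) \<ge> 12"
proof -
  let ?O = "{{1, 2}, {3, 4}, {5, 6}} :: nat set set"
  have "index_pairs - ?O \<subseteq> touching_pairs 6 octahedron"
  proof
    fix A
    assume A: "A \<in> index_pairs - ?O"
    then obtain i j where ij: "A = {i, j}" "i \<noteq> j"
      by (auto simp: card_2_iff)
    with A have range: "i \<in> {1..6}" "j \<in> {1..6}"
      by auto
    with A ij have "octahedron_axis i \<noteq> octahedron_axis j"
      using octahedron_axis_eq_cases(2)[of i j] by blast
    with range ij show "A \<in> touching_pairs 6 octahedron"
      by (simp add: touching_pairs_iff touch_octahedron)
  qed
  then have "card (index_pairs - ?O) \<le> card (touching_pairs 6 octahedron)"
    by (rule card_mono[rotated]) (rule finite_subset[OF touching_pairs_subset], simp)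
  moreover have "card index_pairs - card ?O \<le> card (index_pairs - ?O)"
    by (rule diff_card_le_card_Diff) simp
  moreover have "card ?O \<le> 3"
    by (simp add: card_insert_if)
  ultimately show ?thesis
    using card_index_pairs by linarith
qed

theorem theorem2:
  shows "contact_number 6 = 12"
  unfolding contact_number_def
proof (rule Max_eqI)
  show "y \<le> 12" if "y \<in> {card (touching_pairs 6 x) | x. sphere_packing 6 x}" for y
    using that card_touching_pairs_le_12 by auto
  have "card (touching_pairs 6 octahedron) = 12"
    using card_touching_pairs_le_12[OF sphere_packing_octahedron]
      card_touching_pairs_octahedron by simp
  with sphere_packing_octahedron
  show "12 \<in> {card (touching_pairs 6 x) | x. sphere_packing 6 x}"
    by (metis (mono_tags, lifting) mem_Collect_eq)
qed (rule finite_contact_values)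

end
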